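(* Let $m\ge 1$ be an integer, let $(\mathsf H_i)_{1\le i\le m}$ be separable real Hilbert spaces, and let $\mathsf H=\mathsf H_1\oplus\cdots\oplus\mathsf H_m$ be their direct Hilbert sum. For every $n\in\mathbb N$, let $\{\tau_{i,n}\}_{1\le i\le m}\subset[0,1[$ and let $\mathsf T_n\colon\mathsf H\to\mathsf H\colon \mathsf x\mapsto(\mathsf T_{i,n}\mathsf x)_{1\le i\le m}$ be measurable and quasinonexpansive, where $\mathsf T_{i,n}\colon\mathsf H\to\mathsf H_i$. Suppose that the operators $(\mathsf T_n)_{n\in\mathbb N}$ have a common fixed point $\overline{\mathsf x}=(\overline{\mathsf x}_i)_{1\le i\le m}$ such that $$(\forall n\in\mathbb N)(\forall \mathsf x\in\mathsf H)\quad \|\mathsf T_n\mathsf x-\overline{\mathsf x}\|^2\le\sum_{i=1}^m\tau_{i,n}\|\mathsf x_i-\overline{\mathsf x}_i\|^2 .$$ Let $(\lambda_n)_{n\in\mathbb N}$ be a sequence in $]0,1]$, let $\mathsf D=\{0,1\}^m\smallsetminus\{0\}$, let $x_0$ and $(a_n)_{n\in\mathbb N}=((a_{i,n})_{1\le i\le m})_{n\in\mathbb N}$ be $\mathsf H$-valued random variables, and let $(\varepsilon_n)_{n\in\mathbb N}=((\varepsilon_{i,n})_{1\le i\le m})_{n\in\mathbb N}$ be identically distributed $\mathsf D$-valued random variables. Let $(x_n)_{n\in\mathbb N}=((x_{i,n})_{1\le i\le m})_{n\in\mathbb N}$ be defined by $$(\forall n\in\mathbb N)(\forall i\in\{1,\dots,m\})\quad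 x_{i,n+1}=x_{i,n}+\varepsilon_{i,n}\lambda_n\big(\mathsf T_{i,n}(x_{1,n},\dots,x_{m,n})+a_{i,n}-x_{i,n}\big).$$ Let $(\mathcal F_n)_{n\in\mathbb N}$ be a sequence of sub-sigma-algebras of $\mathcal F$ such that $(\forall n\in\mathbb N)$ $\sigma(x_0,\dots,x_n)\subset\mathcal F_n\subset\mathcal F_{n+1}$. Suppose that the following are satisfied: [a] $\inf_{n\in\mathbb N}\lambda_n>0$. [b] There exists a sequence $(\alpha_n)_{n\in\mathbb N}$ in $[0,+\infty[$ such that $\sum_{n\in\mathbb N}\sqrt{\alpha_n}<+\infty$ and, for every $n\in\mathbb N$, $\mathsf E(\|a_n\|^2\mid\mathcal F_n)\le\alpha_n$. [c] For every $n\in\mathbb N$, $\sigma(\varepsilon_n)$ and $\mathcal F_n$ are independent. [d] For every $i\in\{1,\dots,m\}$, $\mathsf p_i=\mathsf P[\varepsilon_{i,0}=1]>0$. Suppose moreover that $\max_{1\le i\le m}\limsup_{n\to+\infty}\tau_{i,n}<1$, set $$(\forall n\in\mathbb N)\quad \xi_n=\frac{\alpha_n}{\min_{1\le i\le m}\mathsf p_i},\qquad \mu_n=1-\min_{1\le i\le m}\mathsf p_i\,(1-\tau_{i,n}),$$ and define, for every $n\in\mathbb N$, $$\chi_n=1-\lambda_n(1-\mu_n)+\sqrt{\xi_n}\,\lambda_n(1-\lambda_n+\lambda_n\sqrt{\mu_n}),$$ $$\overline\eta_n=\sum_{k=0}^n\Bigg[\prod_{\ell=k+1}^n\chi_\ell\Bigg]\lambda_k\big(1-\lambda_k+\lambda_k\sqrt{\mu_k}+\lambda_k\sqrt{\xi_k}\big)\sqrt{\xi_k}.$$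 Then $$(\forall n\in\mathbb N)\quad \mathsf E\big(\|x_{n+1}-\overline{\mathsf x}\|^2\mid\mathcal F_0\big)\le\frac{\max_{1\le i\le m}\mathsf p_i}{\min_{1\le i\le m}\mathsf p_i}\Bigg(\prod_{k=0}^n\chi_k\Bigg)\|x_0-\overline{\mathsf x}\|^2+\overline\eta_n\quad\mathsf P\text{-a.s.}$$
   Context: The underlying probability space is $(\Omega,\mathcal F,\mathsf P)$. A random variable with values in a separable real Hilbert space is a measurable map from $(\Omega,\mathcal F)$ to the space equipped with its Borel $\sigma$-algebra. The $\sigma$-algebra generated by a family $\Phi$ of random variables is denoted by $\sigma(\Phi)$. The direct Hilbert sum has norm $\|\mathsf x\|^2=\sum_{i=1}^m\|\mathsf x_i\|^2$. Inequalities between conditional expectations are understood $\mathsf P$-a.s., and conditional expectations of nonnegative random variables are taken in $[0,+\infty]$. An operator $\mathsf T\colon\mathsf H\to\mathsf H$ with fixed point set $\operatorname{Fix}\mathsf T$ is quasinonexpansive if $\|\mathsf T\mathsf x-\mathsf z\|\le\|\mathsf x-\mathsf z\|$ for all $\mathsf z\in\operatorname{Fix}\mathsf T$ and all $\mathsf x\in\mathsf H$. In the definition of $\mu_n$, the minimum is over the products $\mathsf p_i(1-\tau_{i,n})$. Convention: an empty product, such as $\prod_{\ell=n+1}^n$, equals $1$. *)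

theory Defs
  imports "HOL-Probability.Probability"
begin

text \<open>
  The summands of the direct Hilbert sum are represented as closed subspaces \<open>H i\<close> of one ambient
  separable real Hilbert space, so that they may differ from one another. Every finite family of
  separable real Hilbert spaces is of this form up to isometry: embed each of them in their direct
  sum. The norm of \<^typ>\<open>'h ^ 'm\<close> is \<open>sqrt (\<Sum>i\<in>UNIV. (norm (x $ i))\<^sup>2)\<close>, as in the direct
  Hilbert sum.
\<close>

definition hilbert_sum :: "('m::finite \<Rightarrow> 'h::real_inner set) \<Rightarrow> ('h ^ 'm) set" where
  "hilbert_sum H = {x. \<forall>i. x $ i \<in> H i}"

text \<open>The Borel sets of a subset \<open>S\<close> with its subspace topology are the traces on \<open>S\<close> of the Borel
  sets of the ambient space.\<close>

abbreviation borel_on :: "'a::topological_space set \<Rightarrow> 'a measure" where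
  "borel_on S \<equiv> restrict_space borel S"

definition Fix_on :: "'a set \<Rightarrow> ('a \<Rightarrow> 'a) \<Rightarrow> 'a set" where
  "Fix_on S T = {x \<in> S. T x = x}"

definition quasinonexpansive_on :: "'a::real_normed_vector set \<Rightarrow> ('a \<Rightarrow> 'a) \<Rightarrow> bool" where
  "quasinonexpansive_on S T \<longleftrightarrow> (\<forall>z\<in>Fix_on S T. \<forall>x\<in>S. norm (T x - z) \<le> norm (x - z))"

text \<open>\<open>{0,1}\<^sup>m\<close> without the zero vector.\<close>

definition activation_set :: "(real ^ 'm::finite) set" where
  "activation_set = {e. \<forall>i. e $ i \<in> {0, 1}} - {0}"

text \<open>The sigma-algebra on the sample space generated by the \<open>N\<close>-valued variables \<open>X i\<close>, \<open>i \<in> I\<close>.\<close>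

definition generated_sigma :: "'w measure \<Rightarrow> 'a measure \<Rightarrow> 'i set \<Rightarrow> ('i \<Rightarrow> 'w \<Rightarrow> 'a) \<Rightarrow> 'w measure"
  where "generated_sigma M N I X =
    sigma (space M) (\<Union>i\<in>I. {X i -` B \<inter> space M |B. B \<in> sets N})"

end

theory Submission
  imports Defs
begin

text \<open>
  The idea is to replace the norm by \<open>V n = (\<Sum>i. (norm (x n $ i - xbar $ i))\<^sup>2 / p i)\<close>. These weights
  cancel the activation probabilities: averaging over \<open>\<epsilon> n\<close>, which is independent of \<open>F n\<close>, the block
  update without errors contracts \<open>V n\<close> by the factor \<open>\<mu> n\<close>. The error \<open>a n\<close> may depend on \<open>\<epsilon> n\<close>, so
  the cross terms are estimated pathwise by Young's inequality, with deterministic weights chosen so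
  that, after conditioning, they contribute exactly the terms with \<open>sqrt (\<xi> n)\<close> in \<open>chi n\<close> and \<open>\<eta> n\<close>.
  The recursion for \<open>V n\<close> is then iterated with the tower property.
\<close>

section \<open>Calculus of conditional expectations of nonnegative functions\<close>

lemma (in sigma_finite_subalgebra) nn_cond_exp_sum_finite:
  fixes f :: "'i \<Rightarrow> 'a \<Rightarrow> ennreal"
  assumes "finite I" and "\<And>i. i \<in> I \<Longrightarrow> f i \<in> borel_measurable M"
  shows "AE w in M. nn_cond_exp M F (\<lambda>w. \<Sum>i\<in>I. f i w) w = (\<Sum>i\<in>I. nn_cond_exp M F (f i) w)"
  using assms
proof (induction I rule: finite_induct)
  case empty
  show ?case
    using nn_cond_exp_F_meas[of "\<lambda>_. 0"] by auto
next
  case (insert i I)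
  have [measurable]: "f i \<in> borel_measurable M" "(\<lambda>w. \<Sum>i\<in>I. f i w) \<in> borel_measurable M"
    using insert.prems by (auto intro!: borel_measurable_sum)
  have "AE w in M. nn_cond_exp M F (\<lambda>w. \<Sum>i\<in>I. f i w) w = (\<Sum>i\<in>I. nn_cond_exp M F (f i) w)"
    using insert by simp
  with nn_cond_exp_sum[of "f i" "\<lambda>w. \<Sum>i\<in>I. f i w"] show ?case
    using insert.hyps by (auto elim!: AE_mp)
qed

text \<open>This turns a pathwise real inequality into a conditional one: the
  \<open>F\<close>-measurable \<open>V\<close> is kept, while \<open>Y\<close> and \<open>G\<close>
  are replaced by bounds on their conditional expectations. All later conditioning of real estimates
  goes through it; slots that an application leaves empty are filled with constants.\<close>

lemma (in sigma_finite_subalgebra) nn_cond_exp_le_lincomb: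
  fixes V Y G U y g :: "'a \<Rightarrow> real" and cV cY cG :: real
  assumes [measurable]: "V \<in> borel_measurable F" "Y \<in> borel_measurable M"
      "G \<in> borel_measurable M" "U \<in> borel_measurable M"
    and nonneg: "0 \<le> cV" "0 \<le> cY" "0 \<le> cG"
      "\<And>w. 0 \<le> V w" "\<And>w. 0 \<le> Y w" "\<And>w. 0 \<le> G w" "\<And>w. 0 \<le> y w" "\<And>w. 0 \<le> g w"
    and U: "\<And>w. w \<in> space M \<Longrightarrow> U w \<le> cV * V w + cY * Y w + cG * G w"
    and Y: "AE w in M. nn_cond_exp M F (\<lambda>w. ennreal (Y w)) w \<le> ennreal (y w)"
    and G: "AE w in M. nn_cond_exp M F (\<lambda>w. ennreal (G w)) w \<le> ennreal (g w)"
  shows "AE w in M. nn_cond_exp M F (\<lambda>w. ennreal (U w)) w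
      \<le> ennreal (cV * V w + cY * y w + cG * g w)"
proof -
  have [measurable]: "V \<in> borel_measurable M"
    by (rule measurable_from_subalg[OF subalg assms(1)])
  define R where "R w = ennreal cV * ennreal (V w) + (ennreal cY * ennreal (Y w) + ennreal cG * ennreal (G w))"
    for w
  have [measurable]: "R \<in> borel_measurable M"
    unfolding R_def by measurable
  have "AE w in M. nn_cond_exp M F (\<lambda>w. ennreal (U w)) w \<le> nn_cond_exp M F R w"
  proof (rule nn_cond_exp_mono)
    show "AE w in M. ennreal (U w) \<le> R w"
    proof (rule AE_I2)
      fix w assume "w \<in> space M"
      then have "ennreal (U w) \<le> ennreal (cV * V w + (cY * Y w + cG * G w))"
        using U[of w] by (intro ennreal_leI) simp
      also have "\<dots> = R w"
        using nonneg by (simp add: R_def ennreal_mult)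
      finally show "ennreal (U w) \<le> R w" .
    qed
  qed measurable
  moreover have "AE w in M. nn_cond_exp M F (\<lambda>w. ennreal cV * ennreal (V w)) w
      + nn_cond_exp M F (\<lambda>w. ennreal cY * ennreal (Y w) + ennreal cG * ennreal (G w)) w = nn_cond_exp M F R w"
    unfolding R_def by (rule nn_cond_exp_sum) measurable
  moreover have "AE w in M. nn_cond_exp M F (\<lambda>w. ennreal cY * ennreal (Y w)) w
      + nn_cond_exp M F (\<lambda>w. ennreal cG * ennreal (G w)) w
      = nn_cond_exp M F (\<lambda>w. ennreal cY * ennreal (Y w) + ennreal cG * ennreal (G w)) w"
    by (rule nn_cond_exp_sum) measurable
  moreover have "AE w in M. ennreal cV * ennreal (V w) = nn_cond_exp M F (\<lambda>w. ennreal cV * ennreal (V w)) w"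
    by (rule nn_cond_exp_F_meas) measurable
  moreover have "AE w in M. ennreal cY * nn_cond_exp M F (\<lambda>w. ennreal (Y w)) w
      = nn_cond_exp M F (\<lambda>w. ennreal cY * ennreal (Y w)) w"
    by (rule nn_cond_exp_prod) measurable
  moreover have "AE w in M. ennreal cG * nn_cond_exp M F (\<lambda>w. ennreal (G w)) w
      = nn_cond_exp M F (\<lambda>w. ennreal cG * ennreal (G w)) w"
    by (rule nn_cond_exp_prod) measurable
  ultimately show ?thesis
    using Y G
  proof eventually_elim
    case (elim w)
    have "nn_cond_exp M F (\<lambda>w. ennreal (U w)) w
      \<le> ennreal cV * ennreal (V w) + (ennreal cY * nn_cond_exp M F (\<lambda>w. ennreal (Y w)) w
        + ennreal cG * nn_cond_exp M F (\<lambda>w. ennreal (G w)) w)"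
      using elim(1-6) by simp
    also have "\<dots> \<le> ennreal cV * ennreal (V w) + (ennreal cY * ennreal (y w) + ennreal cG * ennreal (g w))"
      using elim(7,8) by (intro add_mono mult_left_mono) auto
    also have "\<dots> = ennreal (cV * V w + cY * y w + cG * g w)"
      using nonneg by (simp add: ennreal_mult add.assoc)
    finally show ?case .
  qed
qed

section \<open>Averaging over events independent of the conditioning sigma-algebra\<close>

lemma (in prob_space) nn_cond_exp_indicator_indep:
  assumes F: "subalgebra M F" and A: "A \<in> events"
    and indep: "\<And>B. B \<in> sets F \<Longrightarrow> prob (A \<inter> B) = prob A * prob B"
  shows "AE w in M. nn_cond_exp M F (indicator A) w = ennreal (prob A)"
proof -
  interpret F: finite_measure_subalgebra M F
    by (unfold_locales) (rule F)
  have "AE w in M. ennreal (prob A) = nn_cond_exp M F (indicator A) w"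
  proof (rule F.nn_cond_exp_charact)
    fix B assume B: "B \<in> sets F"
    then have BM: "B \<in> events"
      using F by (auto simp: subalgebra_def)
    have "(\<integral>\<^sup>+w\<in>B. indicator A w \<partial>M) = (\<integral>\<^sup>+w. indicator (A \<inter> B) w \<partial>M)"
      by (intro nn_integral_cong) (auto simp: indicator_def)
    also have "\<dots> = ennreal (prob A * prob B)"
      using A BM by (simp add: emeasure_eq_measure indep[OF B])
    also have "\<dots> = (\<integral>\<^sup>+w\<in>B. ennreal (prob A) \<partial>M)"
      using BM by (simp add: nn_integral_cmult_indicator emeasure_eq_measure ennreal_mult)
    finally show "(\<integral>\<^sup>+w\<in>B. indicator A w \<partial>M) = (\<integral>\<^sup>+w\<in>B. ennreal (prob A) \<partial>M)" .
  qed (use A in measurable)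
  then show ?thesis by (auto elim!: AE_mp)
qed

text \<open>Each summand is \<open>f i\<close> times the indicator of \<open>A i\<close> plus
  \<open>g i\<close> times that of the complement. The \<open>F\<close>-measurable factors come out,
  and both indicators have constant conditional expectation. A summand involves a single event, so
  the events \<open>A i\<close> may depend on one another, as the coordinates of one activation
  vector do.\<close>

lemma (in prob_space) nn_cond_exp_sum_if_indep:
  fixes f g :: "'i \<Rightarrow> 'a \<Rightarrow> real"
  assumes F: "subalgebra M F" and I: "finite I"
    and A: "\<And>i. i \<in> I \<Longrightarrow> A i \<in> events"
    and indep: "\<And>i B. i \<in> I \<Longrightarrow> B \<in> sets F \<Longrightarrow> prob (A i \<inter> B) = prob (A i) * prob B"
    and meas: "\<And>i. i \<in> I \<Longrightarrow> f i \<in> borel_measurable F" "\<And>i. i \<in> I \<Longrightarrow> g i \<in> borel_measurable F"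
    and nonneg: "\<And>i w. 0 \<le> f i w" "\<And>i w. 0 \<le> g i w"
  shows "AE w in M. nn_cond_exp M F (\<lambda>w. ennreal (\<Sum>i\<in>I. if w \<in> A i then f i w else g i w)) w
    = ennreal (\<Sum>i\<in>I. prob (A i) * f i w + (1 - prob (A i)) * g i w)"
proof -
  interpret F: finite_measure_subalgebra M F
    by (unfold_locales) (rule F)
  have split: "AE w in M. nn_cond_exp M F (\<lambda>w. ennreal (if w \<in> A i then f i w else g i w)) w
      = ennreal (prob (A i) * f i w + (1 - prob (A i)) * g i w)" if i: "i \<in> I" for i
  proof -
    note [measurable] = meas[OF i] measurable_from_subalg[OF F meas(1)[OF i]]
      measurable_from_subalg[OF F meas(2)[OF i]] A[OF i]
    define R where "R w = ennreal (f i w) * indicator (A i) w + ennreal (g i w) * indicator (space M - A i) w" for w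
    \<comment> \<open>Independence from \<open>F\<close> passes to the complement, so the indicator
      lemma also applies to the second term of \<open>R\<close>.\<close>
    have "prob ((space M - A i) \<inter> B) = prob (space M - A i) * prob B" if B: "B \<in> sets F" for B
    proof -
      have BM: "B \<in> events"
        using F B by (auto simp: subalgebra_def)
      have "(space M - A i) \<inter> B = B - A i \<inter> B"
        using sets.sets_into_space[OF BM] by auto
      then have "prob ((space M - A i) \<inter> B) = prob B - prob (A i \<inter> B)"
        using A[OF i] BM by (simp add: finite_measure_Diff)
      then show ?thesis
        using A[OF i] by (simp add: indep[OF i B] prob_compl algebra_simps)
    qed
    then have "AE w in M. nn_cond_exp M F (indicator (space M - A i)) w = ennreal (1 - prob (A i))"
      using nn_cond_exp_indicator_indep[OF F, of "space M - A i"] A[OF i] by (simp add: prob_compl)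
    moreover have "AE w in M. nn_cond_exp M F (indicator (A i)) w = ennreal (prob (A i))"
      by (rule nn_cond_exp_indicator_indep[OF F A[OF i] indep[OF i]])
    moreover have "AE w in M. ennreal (f i w) * nn_cond_exp M F (indicator (A i)) w
        = nn_cond_exp M F (\<lambda>w. ennreal (f i w) * indicator (A i) w) w"
      by (rule F.nn_cond_exp_prod) measurable
    moreover have "AE w in M. ennreal (g i w) * nn_cond_exp M F (indicator (space M - A i)) w
        = nn_cond_exp M F (\<lambda>w. ennreal (g i w) * indicator (space M - A i) w) w"
      by (rule F.nn_cond_exp_prod) measurable
    moreover have "AE w in M. nn_cond_exp M F (\<lambda>w. ennreal (f i w) * indicator (A i) w) w
        + nn_cond_exp M F (\<lambda>w. ennreal (g i w) * indicator (space M - A i) w) w = nn_cond_exp M F R w"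
      unfolding R_def by (rule F.nn_cond_exp_sum) measurable
    moreover have "AE w in M. nn_cond_exp M F (\<lambda>w. ennreal (if w \<in> A i then f i w else g i w)) w
        = nn_cond_exp M F R w"
      proof (rule F.nn_cond_exp_cong)
      show "AE w in M. ennreal (if w \<in> A i then f i w else g i w) = R w"
        by (rule AE_I2) (simp add: R_def indicator_def)
    qed (unfold R_def, measurable)
    ultimately show ?thesis
    proof eventually_elim
      case (elim w)
      have "nn_cond_exp M F (\<lambda>w. ennreal (if w \<in> A i then f i w else g i w)) w
        = ennreal (f i w) * ennreal (prob (A i)) + ennreal (g i w) * ennreal (1 - prob (A i))"
        using elim by simp
      also have "\<dots> = ennreal (prob (A i) * f i w + (1 - prob (A i)) * g i w)"
        using nonneg by (simp add: ennreal_mult mult.commute)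
      finally show ?case .
    qed
  qed
  have "AE w in M. \<forall>i\<in>I. nn_cond_exp M F (\<lambda>w. ennreal (if w \<in> A i then f i w else g i w)) w
      = ennreal (prob (A i) * f i w + (1 - prob (A i)) * g i w)"
    using split I by (simp add: AE_finite_all)
  moreover have "AE w in M. nn_cond_exp M F (\<lambda>w. \<Sum>i\<in>I. ennreal (if w \<in> A i then f i w else g i w)) w
      = (\<Sum>i\<in>I. nn_cond_exp M F (\<lambda>w. ennreal (if w \<in> A i then f i w else g i w)) w)"
  proof (rule F.nn_cond_exp_sum_finite[OF I])
    fix i assume i: "i \<in> I"
    note [measurable] = measurable_from_subalg[OF F meas(1)[OF i]]
      measurable_from_subalg[OF F meas(2)[OF i]] A[OF i]
    show "(\<lambda>w. ennreal (if w \<in> A i then f i w else g i w)) \<in> borel_measurable M"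
      by measurable
  qed
  ultimately show ?thesis
  proof eventually_elim
    case (elim w)
    have nn: "0 \<le> prob (A i) * f i w + (1 - prob (A i)) * g i w" for i
      using nonneg[of i w] by simp
    have "(\<lambda>w. ennreal (\<Sum>i\<in>I. if w \<in> A i then f i w else g i w))
        = (\<lambda>w. \<Sum>i\<in>I. ennreal (if w \<in> A i then f i w else g i w))"
      using nonneg by (intro ext) (auto intro!: sum_ennreal[symmetric])
    with elim show ?case
      using nn by simp
  qed
qed

section \<open>Iterating a conditional recursion down to the initial sigma-algebra\<close>

lemma (in prob_space) nn_cond_exp_iterate:
  fixes U :: "nat \<Rightarrow> 'a \<Rightarrow> real" and F :: "nat \<Rightarrow> 'a measure" and c b :: "nat \<Rightarrow> real"
  assumes F: "\<And>n. subalgebra M (F n)" and mono: "\<And>n. sets (F n) \<subseteq> sets (F (Suc n))"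
    and meas: "\<And>n. U n \<in> borel_measurable (F n)"
    and nonneg: "\<And>n w. 0 \<le> U n w" "\<And>n. 0 \<le> c n" "\<And>n. 0 \<le> b n"
    and step: "\<And>n. AE w in M. nn_cond_exp M (F n) (\<lambda>w. ennreal (U (Suc n) w)) w
      \<le> ennreal (c n * U n w + b n)"
  shows "AE w in M. nn_cond_exp M (F 0) (\<lambda>w. ennreal (U (Suc n) w)) w
    \<le> ennreal ((\<Prod>k=0..n. c k) * U 0 w + (\<Sum>k=0..n. (\<Prod>l=k+1..n. c l) * b k))"
proof (induction n)
  case 0
  show ?case using step[of 0] by simp
next
  case (Suc n)
  define S where "S m w = (\<Prod>k=0..m. c k) * U 0 w + (\<Sum>k=0..m. (\<Prod>l=k+1..m. c l) * b k)" for m w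
  have S0: "0 \<le> S m w" for m w
    unfolding S_def using nonneg by (intro add_nonneg_nonneg mult_nonneg_nonneg sum_nonneg prod_nonneg) auto
  \<comment> \<open>The partial bounds satisfy
    \<open>S (Suc n) = c (Suc n) * S n + b (Suc n)\<close>; the new summand \<open>k = Suc n\<close>
    carries an empty product. The factors \<open>1\<close> and \<open>0\<close> match the shape of
    \<open>nn_cond_exp_le_lincomb\<close> with \<open>V = 1\<close> and
    \<open>G = 0\<close>.\<close>
  have S_Suc: "b (Suc n) * 1 + c (Suc n) * S n w + 0 * 0 = S (Suc n) w" for w
  proof -
    have "(\<Sum>k=0..n. (\<Prod>l=k+1..Suc n. c l) * b k) = c (Suc n) * (\<Sum>k=0..n. (\<Prod>l=k+1..n. c l) * b k)"
      unfolding sum_distrib_left by (intro sum.cong refl) (simp add: ac_simps)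
    then show ?thesis
      by (simp add: S_def algebra_simps)
  qed
  interpret F0: finite_measure_subalgebra M "F 0"
    by (unfold_locales) (rule F)
  have [measurable]: "U m \<in> borel_measurable M" for m
    by (rule measurable_from_subalg[OF F meas])
  have sub: "subalgebra (F (Suc n)) (F 0)"
    using F[of "Suc n"] F[of 0] lift_Suc_mono_le[of "\<lambda>n. sets (F n)" 0 "Suc n"] mono
    by (auto simp: subalgebra_def)
  \<comment> \<open>The tower property inserts \<open>F (Suc n)\<close>, where the one-step
    hypothesis applies; the remaining \<open>U (Suc n)\<close> is handled by the induction
    hypothesis.\<close>
  have "AE w in M. nn_cond_exp M (F 0) (\<lambda>w. ennreal (U (Suc (Suc n)) w)) w
      = nn_cond_exp M (F 0) (nn_cond_exp M (F (Suc n)) (\<lambda>w. ennreal (U (Suc (Suc n)) w))) w"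
    by (rule F0.nn_cond_exp_nested_subalg[OF F sub]) measurable
  moreover have "AE w in M. nn_cond_exp M (F 0) (nn_cond_exp M (F (Suc n)) (\<lambda>w. ennreal (U (Suc (Suc n)) w))) w
      \<le> nn_cond_exp M (F 0) (\<lambda>w. ennreal (c (Suc n) * U (Suc n) w + b (Suc n))) w"
    by (rule F0.nn_cond_exp_mono[OF step]) measurable
  moreover have "AE w in M. nn_cond_exp M (F 0) (\<lambda>w. ennreal (c (Suc n) * U (Suc n) w + b (Suc n))) w
      \<le> ennreal (S (Suc n) w)"
    unfolding S_Suc[symmetric]
    by (rule F0.nn_cond_exp_le_lincomb[where Y = "U (Suc n)" and G = "\<lambda>_. 0" and V="\<lambda>_. 1"])
      (use nonneg S0 Suc F0.nn_cond_exp_F_meas[of "\<lambda>_. 0"] in \<open>auto simp: S_def\<close>)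
  ultimately have "AE w in M. nn_cond_exp M (F 0) (\<lambda>w. ennreal (U (Suc (Suc n)) w)) w \<le> ennreal (S (Suc n) w)"
    by eventually_elim simp
  then show ?case
    by (simp only: S_def)
qed

section \<open>Pathwise estimate for a relaxed step with an error\<close>

lemma inner_young:
  fixes u a :: "'h::real_inner"
  assumes "0 < s"
  shows "2 * inner u a \<le> s * (norm u)\<^sup>2 + (norm a)\<^sup>2 / s"
proof -
  have "0 \<le> (norm (s *\<^sub>R u - a))\<^sup>2 / s"
    using assms by simp
  also have "\<dots> = s * (norm u)\<^sup>2 + (norm a)\<^sup>2 / s - 2 * inner u a"
    using assms
    unfolding power2_norm_eq_inner
    by (simp add: inner_diff_left inner_diff_right inner_commute field_simps)
  finally show ?thesis by simp
qed

text \<open>The two cross terms with \<open>a\<close> get separate Young weights, because after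
  averaging the squared norm of \<open>v\<close> gains a factor \<mu> and that of \<open>u\<close>
  does not; the optimal weights therefore differ.\<close>

lemma norm_relaxed_perturbed_le:
  fixes u v a :: "'h::real_inner"
  assumes l: "0 \<le> l" "l \<le> 1" and s: "0 < s" and r: "0 < r"
  shows "(norm ((1 - l) *\<^sub>R u + l *\<^sub>R v + l *\<^sub>R a))\<^sup>2
    \<le> (1 - l + l * (1 - l) * s) * (norm u)\<^sup>2 + (l + l\<^sup>2 * r) * (norm v)\<^sup>2
      + (l * (1 - l) / s + l\<^sup>2 / r + l\<^sup>2) * (norm a)\<^sup>2"
proof -
  have "(norm ((1 - l) *\<^sub>R u + l *\<^sub>R v + l *\<^sub>R a))\<^sup>2
    = (1 - l) * (norm u)\<^sup>2 + l * (norm v)\<^sup>2 - l * (1 - l) * (norm (u - v))\<^sup>2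
      + l * (1 - l) * (2 * inner u a) + l\<^sup>2 * (2 * inner v a) + l\<^sup>2 * (norm a)\<^sup>2"
    unfolding power2_norm_eq_inner
    by (simp add: inner_diff_left inner_diff_right inner_add_left inner_add_right
      inner_commute algebra_simps power2_eq_square)
  \<comment> \<open>The \<open>0\<close> replaces the term
    \<open>l * (1 - l) * (norm (u - v))\<^sup>2\<close> of the convexity identity, which is
    dropped.\<close>
  also have "\<dots> \<le> (1 - l) * (norm u)\<^sup>2 + l * (norm v)\<^sup>2 - 0
      + l * (1 - l) * (s * (norm u)\<^sup>2 + (norm a)\<^sup>2 / s) + l\<^sup>2 * (r * (norm v)\<^sup>2 + (norm a)\<^sup>2 / r)
      + l\<^sup>2 * (norm a)\<^sup>2"
    using l s r by (intro add_mono diff_mono mult_left_mono inner_young order_refl) auto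
  finally show ?thesis
    by (simp add: algebra_simps)
qed

section \<open>One step of the algorithm in the weighted norm\<close>

text \<open>In the application \<open>u\<close>, \<open>v\<close> and \<open>y\<close> are the
  blocks of the current iterate, of its image and of the next iterate, all relative to the fixed
  point, and \<open>A i\<close> is the event that block \<open>i\<close> is activated. The error
  \<open>a\<close> may be correlated with these events, so it is estimated on every block, activated
  or not.\<close>

lemma (in prob_space) nn_cond_exp_block_step:
  fixes u v a :: "'i::finite \<Rightarrow> 'a \<Rightarrow> 'h::real_inner" and A :: "'i \<Rightarrow> 'a set"
    and l \<alpha> :: real and \<tau> :: "'i \<Rightarrow> real"
  defines "p \<equiv> \<lambda>i. prob (A i)"
  defines "\<mu> \<equiv> 1 - (MIN i. p i * (1 - \<tau> i))" and "\<xi> \<equiv> \<alpha> / (MIN i. p i)"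
  assumes F: "subalgebra M F" and A: "\<And>i. A i \<in> events"
    and indep: "\<And>i B. B \<in> sets F \<Longrightarrow> prob (A i \<inter> B) = prob (A i) * prob B"
    and p_pos: "\<And>i. 0 < p i" and \<tau>: "\<And>i. 0 \<le> \<tau> i"
    and l: "0 \<le> l" "l \<le> 1" and \<alpha>: "0 \<le> \<alpha>"
    and u: "\<And>i. (\<lambda>w. norm (u i w)) \<in> borel_measurable F"
    and v: "\<And>i. (\<lambda>w. norm (v i w)) \<in> borel_measurable F"
    and a [measurable]: "\<And>i. (\<lambda>w. norm (a i w)) \<in> borel_measurable M"
    and y [measurable]: "\<And>i. (\<lambda>w. norm (y i w)) \<in> borel_measurable M"
    and y_eq: "\<And>i w. w \<in> space M \<Longrightarrow>
      y i w = (if w \<in> A i then (1 - l) *\<^sub>R u i w + l *\<^sub>R v i w + l *\<^sub>R a i w else u i w)"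
    and v_le: "\<And>w. w \<in> space M \<Longrightarrow> (\<Sum>i\<in>UNIV. (norm (v i w))\<^sup>2) \<le> (\<Sum>i\<in>UNIV. \<tau> i * (norm (u i w))\<^sup>2)"
    and a_le: "AE w in M. nn_cond_exp M F (\<lambda>w. ennreal (\<Sum>i\<in>UNIV. (norm (a i w))\<^sup>2)) w \<le> ennreal \<alpha>"
  shows "AE w in M. nn_cond_exp M F (\<lambda>w. ennreal (\<Sum>i\<in>UNIV. (norm (y i w))\<^sup>2 / p i)) w
    \<le> ennreal ((1 - l * (1 - \<mu>) + sqrt \<xi> * l * (1 - l + l * sqrt \<mu>)) * (\<Sum>i\<in>UNIV. (norm (u i w))\<^sup>2 / p i)
        + l * (1 - l + l * sqrt \<mu> + l * sqrt \<xi>) * sqrt \<xi>)"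
proof -
  interpret F: finite_measure_subalgebra M F
    by (unfold_locales) (rule F)
  note [measurable] = A u v measurable_from_subalg[OF F u] measurable_from_subalg[OF F v]
  define V where "V w = (\<Sum>i\<in>UNIV. (norm (u i w))\<^sup>2 / p i)" for w
  define Y where "Y w = (\<Sum>i\<in>UNIV. if w \<in> A i then (norm (v i w))\<^sup>2 / p i else (norm (u i w))\<^sup>2 / p i)" for w
  define G where "G w = (\<Sum>i\<in>UNIV. (norm (a i w))\<^sup>2)" for w
  define pmin where "pmin = (MIN i. p i)"
  have p_le1: "p i \<le> 1" for i
    by (simp add: p_def)
  have pmin: "0 < pmin" "\<And>i. pmin \<le> p i"
    using p_pos by (simp_all add: pmin_def)
  have \<mu>_le: "1 - \<mu> \<le> p i * (1 - \<tau> i)" for i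
    by (simp add: \<mu>_def)
  \<comment> \<open>Any index gives \<open>1 - \<mu> \<le> p i * (1 - \<tau> i) \<le> 1\<close>, and
    the index type is inhabited.\<close>
  have \<mu>: "0 \<le> \<mu>"
  proof -
    obtain i :: 'i where True by simp
    have "p i * (1 - \<tau> i) \<le> p i * 1"
      using \<tau> p_pos[of i] by (intro mult_left_mono) auto
    with \<mu>_le[of i] p_le1[of i] show ?thesis by simp
  qed
  have \<xi>: "0 \<le> \<xi>" "\<xi> = \<alpha> / pmin"
    using pmin(1) \<alpha> by (simp_all add: \<xi>_def pmin_def[symmetric])
  have VF [measurable]: "V \<in> borel_measurable F"
    unfolding V_def by measurable
  have [measurable]: "Y \<in> borel_measurable M" "G \<in> borel_measurable M"
    unfolding Y_def G_def by measurable
  have V0: "0 \<le> V w" and Y0: "0 \<le> Y w" and G0: "0 \<le> G w" for w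
    unfolding V_def Y_def G_def using p_pos by (auto intro!: sum_nonneg simp: less_imp_le)

  \<comment> \<open>The weight \<open>1 / p i\<close> cancels the probability in front of the
    squared norm of \<open>v i\<close>, which leaves the unweighted sum that \<open>v_le\<close>
    controls. Then block \<open>i\<close> of \<open>V\<close> has coefficient
    \<open>1 - p i * (1 - \<tau> i)\<close>, at most \<mu>.\<close>
  have EY: "AE w in M. nn_cond_exp M F (\<lambda>w. ennreal (Y w)) w \<le> ennreal (\<mu> * V w)"
  proof -
    have "AE w in M. nn_cond_exp M F (\<lambda>w. ennreal (Y w)) w
        = ennreal (\<Sum>i\<in>UNIV. prob (A i) * ((norm (v i w))\<^sup>2 / p i) + (1 - prob (A i)) * ((norm (u i w))\<^sup>2 / p i))"
      unfolding Y_def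
      by (rule nn_cond_exp_sum_if_indep[OF F _ A indep]) (use p_pos in \<open>auto simp: less_imp_le\<close>)
    with AE_space show ?thesis
    proof eventually_elim
      case (elim w)
      have "(\<Sum>i\<in>UNIV. p i * ((norm (v i w))\<^sup>2 / p i) + (1 - p i) * ((norm (u i w))\<^sup>2 / p i))
          = (\<Sum>i\<in>UNIV. (norm (v i w))\<^sup>2) + (\<Sum>i\<in>UNIV. (1 - p i) * ((norm (u i w))\<^sup>2 / p i))"
        using p_pos by (simp add: sum.distrib less_imp_neq[THEN not_sym])
      also have "\<dots> \<le> (\<Sum>i\<in>UNIV. \<tau> i * (norm (u i w))\<^sup>2) + (\<Sum>i\<in>UNIV. (1 - p i) * ((norm (u i w))\<^sup>2 / p i))"
        using v_le[OF elim(1)] by simp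
      also have "\<dots> = (\<Sum>i\<in>UNIV. (1 - p i * (1 - \<tau> i)) * ((norm (u i w))\<^sup>2 / p i))"
        unfolding sum.distrib[symmetric]
        using p_pos by (intro sum.cong refl) (simp add: field_simps less_imp_neq[THEN not_sym])
      also have "\<dots> \<le> (\<Sum>i\<in>UNIV. \<mu> * ((norm (u i w))\<^sup>2 / p i))"
        using \<mu>_le p_pos by (intro sum_mono mult_right_mono) (auto simp: less_imp_le algebra_simps)
      finally show ?case
        using elim(2) by (simp add: V_def sum_distrib_left p_def ennreal_leI)
    qed
  qed

  \<comment> \<open>The weights \<open>s\<close> and \<open>r\<close> are deterministic, so they
    pass through the conditional expectation; they stay free until the bound is optimized.\<close>
  have young: "AE w in M. nn_cond_exp M F (\<lambda>w. ennreal (\<Sum>i\<in>UNIV. (norm (y i w))\<^sup>2 / p i)) w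
      \<le> ennreal ((1 - l + l * (1 - l) * s) * V w + (l + l\<^sup>2 * r) * (\<mu> * V w)
        + (l * (1 - l) / s + l\<^sup>2 / r + l\<^sup>2) / pmin * \<alpha>)"
    if s: "0 < s" and r: "0 < r" for s r
  proof (rule F.nn_cond_exp_le_lincomb[OF _ _ _ _ _ _ _ V0 Y0 G0])
    define k where "k = l * (1 - l) / s + l\<^sup>2 / r + l\<^sup>2"
    have k0: "0 \<le> k"
      unfolding k_def using l s r by simp
    show "(\<Sum>i\<in>UNIV. (norm (y i w))\<^sup>2 / p i)
        \<le> (1 - l + l * (1 - l) * s) * V w + (l + l\<^sup>2 * r) * Y w + (l * (1 - l) / s + l\<^sup>2 / r + l\<^sup>2) / pmin * G w"
      if w: "w \<in> space M" for w
    proof -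
      have "(norm (y i w))\<^sup>2 \<le> (1 - l + l * (1 - l) * s) * (norm (u i w))\<^sup>2
          + (l + l\<^sup>2 * r) * (if w \<in> A i then (norm (v i w))\<^sup>2 else (norm (u i w))\<^sup>2) + k * (norm (a i w))\<^sup>2" for i
      proof (cases "w \<in> A i")
        case True
        then show ?thesis
          using norm_relaxed_perturbed_le[OF l s r, of "u i w" "v i w" "a i w"]
          by (simp add: y_eq[OF w] k_def)
      next
        case False
        \<comment> \<open>An inactive block keeps its norm. Splitting its coefficient as
          \<open>1 - l\<close> plus \<open>l\<close> lets it be dominated term by term by the bound
          for an active block.\<close>
        have "(norm (u i w))\<^sup>2 = (1 - l + l * (1 - l) * 0) * (norm (u i w))\<^sup>2 + (l + l\<^sup>2 * 0) * (norm (u i w))\<^sup>2 + 0"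
          by (simp add: algebra_simps)
        also have "\<dots> \<le> (1 - l + l * (1 - l) * s) * (norm (u i w))\<^sup>2
            + (l + l\<^sup>2 * r) * (norm (u i w))\<^sup>2 + k * (norm (a i w))\<^sup>2"
          using l s r k0 by (intro add_mono mult_right_mono mult_left_mono) auto
        finally show ?thesis
          using False by (simp add: y_eq[OF w])
      qed
      then have "(norm (y i w))\<^sup>2 / p i \<le> ((1 - l + l * (1 - l) * s) * (norm (u i w))\<^sup>2
          + (l + l\<^sup>2 * r) * (if w \<in> A i then (norm (v i w))\<^sup>2 else (norm (u i w))\<^sup>2)
          + k * (norm (a i w))\<^sup>2) / p i" for i
        using p_pos[of i] by (intro divide_right_mono) auto
      also have "\<dots> i = (1 - l + l * (1 - l) * s) * ((norm (u i w))\<^sup>2 / p i)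
          + (l + l\<^sup>2 * r) * (if w \<in> A i then (norm (v i w))\<^sup>2 / p i else (norm (u i w))\<^sup>2 / p i)
          + k * (norm (a i w))\<^sup>2 / p i" for i
        by (simp add: add_divide_distrib)
      \<comment> \<open>Only the unweighted sum of squared errors has a conditional bound, so
        \<open>1 / p i\<close> is enlarged to \<open>1 / pmin\<close>; this is the source of
        \<open>\<xi> = \<alpha> / pmin\<close>.\<close>
      also have "\<dots> i \<le> (1 - l + l * (1 - l) * s) * ((norm (u i w))\<^sup>2 / p i)
          + (l + l\<^sup>2 * r) * (if w \<in> A i then (norm (v i w))\<^sup>2 / p i else (norm (u i w))\<^sup>2 / p i)
          + k / pmin * (norm (a i w))\<^sup>2" for i
        using divide_left_mono[OF pmin(2)[of i], of "k * (norm (a i w))\<^sup>2"] k0 pmin(1) p_pos[of i] by simp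
      finally show ?thesis
        unfolding V_def Y_def G_def k_def[symmetric] sum_distrib_left sum.distrib[symmetric]
        by (intro sum_mono)
    qed
  qed (use l s r pmin(1) \<mu> V0 \<alpha> EY a_le in \<open>auto simp: G_def\<close>)

  \<comment> \<open>The optimal Young weights degenerate when \<open>\<xi>\<close> or \<open>\<mu>\<close> vanishes, hence the shift by \<open>d > 0\<close>,
    which is sent to \<open>0\<close> at the end.\<close>
  define B where "B d W = (1 - l * (1 - \<mu>) + sqrt (\<xi> + d) * l * (1 - l + l * sqrt (\<mu> + d))) * W
        + l * (1 - l + l * sqrt (\<mu> + d) + l * sqrt (\<xi> + d)) * sqrt (\<xi> + d)" for d W
  have bound: "AE w in M. nn_cond_exp M F (\<lambda>w. ennreal (\<Sum>i\<in>UNIV. (norm (y i w))\<^sup>2 / p i)) w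
      \<le> ennreal (B d (V w))" if d: "0 < d" for d
  proof -
    \<comment> \<open>The Young weights are \<open>s\<close> and \<open>s / m\<close>. With \<mu> at
      most \<open>m * m\<close> and \<xi> at most \<open>s * s\<close>, the cross term of
      \<open>v\<close> and \<open>a\<close> contributes at most \<open>l\<^sup>2 * s * m\<close> to
      the factor of \<open>V\<close> and the same amount to the constant, and the bound collapses to
      \<open>B d\<close>.\<close>
    define s m where "s = sqrt (\<xi> + d)" and "m = sqrt (\<mu> + d)"
    have s: "0 < s" "\<xi> \<le> s * s" and m: "0 < m" "\<mu> \<le> m * m"
      using \<xi>(1) \<mu> d by (simp_all add: s_def m_def)
    have "(1 - l + l * (1 - l) * s) * W + (l + l\<^sup>2 * (s / m)) * (\<mu> * W)
        + (l * (1 - l) / s + l\<^sup>2 / (s / m) + l\<^sup>2) / pmin * \<alpha> \<le> B d W" if W: "0 \<le> W" for W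
    proof -
      have "(1 - l + l * (1 - l) * s) * W + (l + l\<^sup>2 * (s / m)) * (\<mu> * W)
          + (l * (1 - l) / s + l\<^sup>2 / (s / m) + l\<^sup>2) / pmin * \<alpha>
        = (1 - l + l * (1 - l) * s + l * \<mu>) * W + l\<^sup>2 * (s / m * W) * \<mu>
          + (l * (1 - l) / s + l\<^sup>2 * m / s + l\<^sup>2) * \<xi>"
        using s m by (simp add: \<xi>(2) field_simps)
      also have "\<dots> \<le> (1 - l + l * (1 - l) * s + l * \<mu>) * W + l\<^sup>2 * (s / m * W) * (m * m)
          + (l * (1 - l) / s + l\<^sup>2 * m / s + l\<^sup>2) * (s * s)"
        using s m l W by (intro add_mono mult_left_mono order_refl) auto
      also have "\<dots> = B d W"
        unfolding B_def s_def[symmetric] m_def[symmetric] using s(1) m(1)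
        by (simp add: field_simps power2_eq_square)
      finally show ?thesis .
    qed
    then have "(1 - l + l * (1 - l) * s) * V w + (l + l\<^sup>2 * (s / m)) * (\<mu> * V w)
        + (l * (1 - l) / s + l\<^sup>2 / (s / m) + l\<^sup>2) / pmin * \<alpha> \<le> B d (V w)" for w
      using V0 by blast
    with young[of s "s / m"] s m show ?thesis
      by (auto elim!: AE_mp intro: order_trans ennreal_leI)
  qed
  \<comment> \<open>The exceptional null set depends on \<open>d\<close>. Restricting to the
    sequence \<open>1 / (k + 1)\<close> gives one null set off which the limit can be taken.\<close>
  have "AE w in M. \<forall>k. nn_cond_exp M F (\<lambda>w. ennreal (\<Sum>i\<in>UNIV. (norm (y i w))\<^sup>2 / p i)) w
      \<le> ennreal (B (inverse (real (Suc k))) (V w))"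
    using bound by (simp add: AE_all_countable)
  then show ?thesis
  proof eventually_elim
    case (elim w)
    have "isCont (\<lambda>d. B d (V w)) 0"
      unfolding B_def by (intro continuous_intros)
    then have "(\<lambda>k. ennreal (B (inverse (real (Suc k))) (V w))) \<longlonglongrightarrow> ennreal (B 0 (V w))"
      by (intro tendsto_ennrealI isCont_tendsto_compose[OF _ LIMSEQ_inverse_real_of_nat])
    then have "nn_cond_exp M F (\<lambda>w. ennreal (\<Sum>i\<in>UNIV. (norm (y i w))\<^sup>2 / p i)) w \<le> ennreal (B 0 (V w))"
      by (rule LIMSEQ_le_const) (use elim in blast)
    then show ?case
      by (simp add: B_def V_def)
  qed
qed

lemma vimage_in_generated_sigma:
  assumes "i \<in> I" "B \<in> sets N"
  shows "X i -` B \<inter> space M \<in> sets (generated_sigma M N I X)"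
  unfolding generated_sigma_def using assms by (intro in_measure_of) auto

theorem corollary3p2:
  fixes M :: "'w measure"
    and H :: "'m::finite \<Rightarrow> 'h::{real_inner, polish_space} set"
    and \<tau> :: "'m \<Rightarrow> nat \<Rightarrow> real"
    and T :: "nat \<Rightarrow> 'h ^ 'm \<Rightarrow> 'h ^ 'm"
    and xbar :: "'h ^ 'm"
    and lam :: "nat \<Rightarrow> real"
    and x a :: "nat \<Rightarrow> 'w \<Rightarrow> 'h ^ 'm"
    and \<epsilon> :: "nat \<Rightarrow> 'w \<Rightarrow> real ^ 'm"
    and F :: "nat \<Rightarrow> 'w measure"
    and \<alpha> \<xi> \<mu> chi \<eta> :: "nat \<Rightarrow> real"
    and p :: "'m \<Rightarrow> real"
  assumes prob: "prob_space M"
    and H: "\<And>i. subspace (H i)" "\<And>i. closed (H i)"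
    and tau: "\<And>i n. 0 \<le> \<tau> i n" "\<And>i n. \<tau> i n < 1"
    and T_meas: "\<And>n. T n \<in> borel_on (hilbert_sum H) \<rightarrow>\<^sub>M borel_on (hilbert_sum H)"
    and T_qne: "\<And>n. quasinonexpansive_on (hilbert_sum H) (T n)"
    and xbar_fix: "\<And>n. xbar \<in> Fix_on (hilbert_sum H) (T n)"
    and T_bound: "\<And>n y. y \<in> hilbert_sum H \<Longrightarrow>
      (norm (T n y - xbar))\<^sup>2 \<le> (\<Sum>i\<in>UNIV. \<tau> i n * (norm (y $ i - xbar $ i))\<^sup>2)"
    and lam: "\<And>n. 0 < lam n" "\<And>n. lam n \<le> 1"
    and x0: "x 0 \<in> M \<rightarrow>\<^sub>M borel_on (hilbert_sum H)"
    and a_rv: "\<And>n. a n \<in> M \<rightarrow>\<^sub>M borel_on (hilbert_sum H)"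
    and eps_rv: "\<And>n. \<epsilon> n \<in> M \<rightarrow>\<^sub>M count_space activation_set"
    and eps_id: "\<And>n. distr M (count_space activation_set) (\<epsilon> n) =
      distr M (count_space activation_set) (\<epsilon> 0)"
    and x_rec: "\<And>n i w. w \<in> space M \<Longrightarrow>
      x (Suc n) w $ i =
        x n w $ i + (\<epsilon> n w $ i * lam n) *\<^sub>R (T n (x n w) $ i + a n w $ i - x n w $ i)"
    and F_sub: "\<And>n. subalgebra M (F n)"
    and F_gen: "\<And>n. sets (generated_sigma M (borel_on (hilbert_sum H)) {..n} x) \<subseteq> sets (F n)"
    and F_mono: "\<And>n. sets (F n) \<subseteq> sets (F (Suc n))"
    and a: "(INF n. lam n) > 0"
    and b: "\<And>n. 0 \<le> \<alpha> n" "summable (\<lambda>n. sqrt (\<alpha> n))"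
      "\<And>n. AE w in M. nn_cond_exp M (F n) (\<lambda>w. ennreal ((norm (a n w))\<^sup>2)) w \<le> ennreal (\<alpha> n)"
    and c: "\<And>n. prob_space.indep_set M
      (sets (generated_sigma M (count_space activation_set) {n} \<epsilon>)) (sets (F n))"
    and p: "\<And>i. p i = \<P>(w in M. \<epsilon> 0 w $ i = 1)"
    and d: "\<And>i. p i > 0"
    and limsup_tau: "(MAX i. limsup (\<lambda>n. ereal (\<tau> i n))) < 1"
    and xi: "\<And>n. \<xi> n = \<alpha> n / (MIN i. p i)"
    and mu: "\<And>n. \<mu> n = 1 - (MIN i. p i * (1 - \<tau> i n))"
    and chi_def: "\<And>n. chi n =
      1 - lam n * (1 - \<mu> n) + sqrt (\<xi> n) * lam n * (1 - lam n + lam n * sqrt (\<mu> n))"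
    and eta: "\<And>n. \<eta> n = (\<Sum>k=0..n. (\<Prod>l=k+1..n. chi l) *
      lam k * (1 - lam k + lam k * sqrt (\<mu> k) + lam k * sqrt (\<xi> k)) * sqrt (\<xi> k))"
  shows "\<forall>n. AE w in M.
    nn_cond_exp M (F 0) (\<lambda>w. ennreal ((norm (x (Suc n) w - xbar))\<^sup>2)) w
      \<le> ennreal ((MAX i. p i) / (MIN i. p i) * (\<Prod>k=0..n. chi k) * (norm (x 0 w - xbar))\<^sup>2 + \<eta> n)"
proof
  fix n
  interpret prob_space M by (rule prob)

  \<comment> \<open>Invariance of the direct sum, measurability, and activation events\<close>
  let ?S = "hilbert_sum H"
  let ?act = "\<lambda>n i. {w \<in> space M. \<epsilon> n w $ i = 1}"
  have T_S: "T n y \<in> ?S" if "y \<in> ?S" for n y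
    using measurable_space[OF T_meas[of n], of y] that by (simp add: space_restrict_space)
  have a_S: "a n w \<in> ?S" if "w \<in> space M" for n w
    using measurable_space[OF a_rv[of n] that] by (simp add: space_restrict_space)
  \<comment> \<open>The properties of \<open>T n\<close> hold only on the direct sum. The iterates
    stay there because each block is updated within the subspace \<open>H i\<close>.\<close>
  have x_S: "x n w \<in> ?S" if w: "w \<in> space M" for n w
  proof (induction n)
    case 0
    show ?case
      using measurable_space[OF x0 w] by (simp add: space_restrict_space)
  next
    case (Suc n)
    show ?case
      unfolding hilbert_sum_def
      using Suc T_S[OF Suc, of n] a_S[OF w, of n] H(1)
      by (auto simp: x_rec[OF w] hilbert_sum_def intro!: subspace_add subspace_scale subspace_diff)
  qed
  have space_F: "space (F n) = space M" for n
    using F_sub[of n] by (simp add: subalgebra_def)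
  have x_meas_S: "x n \<in> F n \<rightarrow>\<^sub>M borel_on ?S" for n
  proof (rule measurableI)
    fix B assume "B \<in> sets (borel_on ?S)"
    then have "x n -` B \<inter> space M \<in> sets (generated_sigma M (borel_on ?S) {..n} x)"
      by (intro vimage_in_generated_sigma) simp_all
    then show "x n -` B \<inter> space (F n) \<in> sets (F n)"
      using F_gen[of n] by (auto simp: space_F)
  qed (simp add: space_F x_S space_restrict_space)
  have coord: "(\<lambda>w. norm (f w $ i - c)) \<in> borel_measurable N"
    if "f \<in> N \<rightarrow>\<^sub>M borel_on ?S" for f :: "'w \<Rightarrow> 'h ^ 'm" and N i c
  proof -
    have "f \<in> borel_measurable N"
      using that by (simp add: measurable_restrict_space2_iff)
    moreover have "(\<lambda>y. norm (y $ i - c)) \<in> borel_measurable borel"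
      by (intro borel_measurable_continuous_onI continuous_intros)
    ultimately show ?thesis
      by (rule measurable_compose)
  qed
  have [measurable]: "?act n i \<in> events" for n i
    using measurable_sets[OF eps_rv[of n], of "{e \<in> activation_set. e $ i = 1}"]
      measurable_space[OF eps_rv[of n]]
    by (auto simp: vimage_def Int_def conj_commute cong: conj_cong)
  \<comment> \<open>Identical distribution makes the activation probabilities, and hence the weights
    \<open>1 / p i\<close>, the same at every step.\<close>
  have act_prob: "prob (?act n i) = p i" for n i
  proof -
    let ?E = "{e \<in> activation_set. e $ i = (1::real)}"
    have "prob (?act n i) = measure (distr M (count_space activation_set) (\<epsilon> n)) ?E" for n
      using measurable_space[OF eps_rv[of n]] eps_rv[of n]
      by (auto simp: measure_distr intro!: arg_cong[where f = prob])
    then show ?thesis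
      using eps_id[of n] by (simp add: p)
  qed
  have act_indep: "prob (?act n i \<inter> B) = prob (?act n i) * prob B" if "B \<in> sets (F n)" for n i B
  proof (rule indep_setD[OF c[of n] _ that])
    have eq: "?act n i = \<epsilon> n -` {e \<in> activation_set. e $ i = 1} \<inter> space M"
      using measurable_space[OF eps_rv[of n]] by auto
    show "?act n i \<in> sets (generated_sigma M (count_space activation_set) {n} \<epsilon>)"
      unfolding eq by (rule vimage_in_generated_sigma) auto
  qed

  \<comment> \<open>The weighted squared distance and the signs of the coefficients\<close>
  define V where "V n w = (\<Sum>i\<in>UNIV. (norm (x n w $ i - xbar $ i))\<^sup>2 / p i)" for n w
  define b' where "b' n = lam n * (1 - lam n + lam n * sqrt (\<mu> n) + lam n * sqrt (\<xi> n)) * sqrt (\<xi> n)" for n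
  have pmin: "0 < (MIN i. p i)" "\<And>i. (MIN i. p i) \<le> p i" and pmax: "\<And>i. p i \<le> (MAX i. p i)"
    using d by simp_all
  have pmax_pos: "0 < (MAX i. p i)"
    using d pmax less_le_trans by blast
  have p_le1: "p i \<le> 1" for i
    by (simp add: p)
  have \<mu>: "0 \<le> \<mu> n" for n
  proof -
    obtain i :: 'm where True by simp
    have "(MIN i. p i * (1 - \<tau> i n)) \<le> p i * (1 - \<tau> i n)"
      by simp
    also have "\<dots> \<le> 1"
      using p_le1[of i] d[of i] tau[of i n] by (intro mult_le_one) auto
    finally show ?thesis by (simp add: mu)
  qed
  have \<xi>: "0 \<le> \<xi> n" for n
    unfolding xi using b(1)[of n] pmin(1) by (intro divide_nonneg_pos)
  have chi_nonneg: "0 \<le> chi n" for n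
  proof -
    have "chi n = (1 - lam n) + lam n * \<mu> n + sqrt (\<xi> n) * lam n * (1 - lam n + lam n * sqrt (\<mu> n))"
      by (simp add: chi_def algebra_simps)
    then show ?thesis
      using lam[of n] \<mu>[of n] \<xi>[of n] by (simp add: less_imp_le)
  qed
  have b'_nonneg: "0 \<le> b' n" for n
    using lam[of n] \<mu>[of n] \<xi>[of n] by (simp add: b'_def less_imp_le)

  have norm_diff: "(norm (y - xbar))\<^sup>2 = (\<Sum>i\<in>UNIV. (norm (y $ i - xbar $ i))\<^sup>2)" for y
    by (simp add: norm_vec_def L2_set_def sum_nonneg)
  \<comment> \<open>Passing from the norm to \<open>V\<close> costs \<open>MAX i. p i\<close>, and
    passing back costs the reciprocal of \<open>MIN i. p i\<close>; this is the ratio in the final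
    estimate.\<close>
  have norm_le_V: "(norm (x n w - xbar))\<^sup>2 \<le> (MAX i. p i) * V n w" for n w
    unfolding norm_diff V_def sum_distrib_left
  proof (rule sum_mono)
    fix i
    have "(norm (x n w $ i - xbar $ i))\<^sup>2 = p i * ((norm (x n w $ i - xbar $ i))\<^sup>2 / p i)"
      using d[of i] by simp
    also have "\<dots> \<le> (MAX i. p i) * ((norm (x n w $ i - xbar $ i))\<^sup>2 / p i)"
      using d[of i] pmax by (intro mult_right_mono) auto
    finally show "(norm (x n w $ i - xbar $ i))\<^sup>2 \<le> (MAX i. p i) * ((norm (x n w $ i - xbar $ i))\<^sup>2 / p i)" .
  qed
  have V_le_norm: "V n w \<le> (norm (x n w - xbar))\<^sup>2 / (MIN i. p i)" for n w
    unfolding norm_diff V_def sum_divide_distrib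
    using pmin d by (intro sum_mono divide_left_mono) auto
  have V_meas: "V n \<in> borel_measurable (F n)" for n
    unfolding V_def using coord[OF x_meas_S]
    by (intro borel_measurable_sum borel_measurable_divide borel_measurable_power) auto
  have V_nonneg: "0 \<le> V n w" for n w
    unfolding V_def using d by (intro sum_nonneg) (simp add: less_imp_le)

  \<comment> \<open>The one-step recursion for the iterates\<close>
  have step: "AE w in M. nn_cond_exp M (F n) (\<lambda>w. ennreal (V (Suc n) w)) w \<le> ennreal (chi n * V n w + b' n)" for n
    \<comment> \<open>Reading \<open>act_prob\<close> backwards writes every \<open>p i\<close> as
      the probability of the activation event at time \<open>n\<close>, which is the form used in
      the block lemma.\<close>
    unfolding V_def chi_def b'_def mu xi act_prob[of n, symmetric]
  proof (rule nn_cond_exp_block_step[OF F_sub _ act_indep,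
        where v = "\<lambda>i w. T n (x n w) $ i - xbar $ i" and a = "\<lambda>i w. a n w $ i"])
    show "(\<lambda>w. norm (a n w $ i)) \<in> borel_measurable M" for i
      using coord[OF a_rv, of n i 0] by simp
    show "(\<lambda>w. norm (T n (x n w) $ i - xbar $ i)) \<in> borel_measurable (F n)" for i
      by (rule coord[OF measurable_compose[OF x_meas_S T_meas]])
    show "(\<lambda>w. norm (x (Suc n) w $ i - xbar $ i)) \<in> borel_measurable M" for i
      by (rule measurable_from_subalg[OF F_sub coord[OF x_meas_S]])
    show "AE w in M. nn_cond_exp M (F n) (\<lambda>w. ennreal (\<Sum>i\<in>UNIV. (norm (a n w $ i))\<^sup>2)) w \<le> ennreal (\<alpha> n)"
      using b(3)[of n] by (simp add: norm_vec_def L2_set_def sum_nonneg)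
    show "(\<Sum>i\<in>UNIV. (norm (T n (x n w) $ i - xbar $ i))\<^sup>2)
        \<le> (\<Sum>i\<in>UNIV. \<tau> i n * (norm (x n w $ i - xbar $ i))\<^sup>2)" if "w \<in> space M" for w
      using T_bound[OF x_S[OF that], of n n] by (simp add: norm_diff)
    show "x (Suc n) w $ i - xbar $ i = (if w \<in> ?act n i then (1 - lam n) *\<^sub>R (x n w $ i - xbar $ i)
        + lam n *\<^sub>R (T n (x n w) $ i - xbar $ i) + lam n *\<^sub>R (a n w $ i) else x n w $ i - xbar $ i)"
      if w: "w \<in> space M" for w i
    proof -
      have "\<epsilon> n w $ i \<in> {0, 1}"
        using measurable_space[OF eps_rv[of n] w] by (auto simp: activation_set_def)
      then show ?thesis
        using w by (auto simp: x_rec[OF w] algebra_simps)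
    qed
  qed (use lam tau d b(1) coord[OF x_meas_S] in \<open>auto simp: act_prob less_imp_le\<close>)

  \<comment> \<open>Iteration and return to the original norm\<close>
  have main: "AE w in M. nn_cond_exp M (F 0) (\<lambda>w. ennreal (V (Suc n) w)) w
      \<le> ennreal ((\<Prod>k=0..n. chi k) * V 0 w + (\<Sum>k=0..n. (\<Prod>l=k+1..n. chi l) * b' k))"
    by (rule nn_cond_exp_iterate[where U = V and F = F and c = chi and b = b', OF F_sub F_mono V_meas V_nonneg chi_nonneg b'_nonneg step])
  have \<eta>_eq: "(\<Sum>k=0..n. (\<Prod>l=k+1..n. chi l) * b' k) = \<eta> n"
    unfolding eta b'_def by (simp add: mult.assoc)
  have \<eta>_nonneg: "0 \<le> \<eta> n"
    unfolding \<eta>_eq[symmetric] using chi_nonneg b'_nonneg by (intro sum_nonneg mult_nonneg_nonneg prod_nonneg) auto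
  have prod_nonneg': "0 \<le> (\<Prod>k=0..n. chi k)"
    using chi_nonneg by (simp add: prod_nonneg)

  interpret F0: finite_measure_subalgebra M "F 0"
    by (unfold_locales) (rule F_sub)
  have [measurable]: "V (Suc n) \<in> borel_measurable M"
    by (rule measurable_from_subalg[OF F_sub V_meas])
  have [measurable]: "(\<lambda>w. (norm (x (Suc n) w - xbar))\<^sup>2) \<in> borel_measurable M"
    unfolding norm_diff using measurable_from_subalg[OF F_sub coord[OF x_meas_S]]
    by (intro borel_measurable_sum borel_measurable_power) auto
  have "AE w in M. nn_cond_exp M (F 0) (\<lambda>w. ennreal ((norm (x (Suc n) w - xbar))\<^sup>2)) w
      \<le> ennreal (0 * 0 + (MAX i. p i) * ((\<Prod>k=0..n. chi k) * V 0 w + \<eta> n) + 0 * 0)"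
    by (rule F0.nn_cond_exp_le_lincomb[where V = "\<lambda>_. 0" and Y = "V (Suc n)" and G = "\<lambda>_. 0"])
      (use main[unfolded \<eta>_eq] \<eta>_nonneg prod_nonneg' V_nonneg norm_le_V pmax_pos F0.nn_cond_exp_F_meas[of "\<lambda>_. 0"]
        in auto)
  moreover have "(MAX i. p i) * ((\<Prod>k=0..n. chi k) * V 0 w + \<eta> n)
      \<le> (MAX i. p i) / (MIN i. p i) * (\<Prod>k=0..n. chi k) * (norm (x 0 w - xbar))\<^sup>2 + \<eta> n" for w
  proof -
    have "(MAX i. p i) * ((\<Prod>k=0..n. chi k) * V 0 w)
        \<le> (MAX i. p i) * ((\<Prod>k=0..n. chi k) * ((norm (x 0 w - xbar))\<^sup>2 / (MIN i. p i)))"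
      using V_le_norm prod_nonneg' pmax_pos by (intro mult_left_mono) auto
    moreover have "(MAX i. p i) * \<eta> n \<le> \<eta> n"
      using \<eta>_nonneg p_le1 pmax_pos by (intro mult_left_le_one_le) auto
    ultimately show ?thesis
      by (simp add: algebra_simps)
  qed
  ultimately show "AE w in M. nn_cond_exp M (F 0) (\<lambda>w. ennreal ((norm (x (Suc n) w - xbar))\<^sup>2)) w
      \<le> ennreal ((MAX i. p i) / (MIN i. p i) * (\<Prod>k=0..n. chi k) * (norm (x 0 w - xbar))\<^sup>2 + \<eta> n)"
    by (auto elim!: AE_mp intro: order_trans ennreal_leI)
qed

end
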